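(* Let $n\ge 1$ and $t\ge 1$ be integers. Every red-blue $K_n$ has at most $2n\left(\frac{n-1}{2}\right)^{t}$ alternating walks of length $t$. Equality is attained for colourings in which every vertex is incident with exactly $\frac{n-1}{2}$ red and $\frac{n-1}{2}$ blue edges.
   Context: A red-blue $K_n$ is a complete graph on $n$ vertices each of whose edges is coloured either red or blue. A walk of length $t$ is an ordered tuple $(v_0,v_1,\ldots,v_t)$ of vertices such that $v_{i-1}v_i$ is an edge for each $i\in\{1,\ldots,t\}$ (vertices may repeat; a walk and its reversal are different walks). A walk is alternating if $v_{i-1}v_i$ and $v_iv_{i+1}$ have different colours for each $i\in\{1,\ldots,t-1\}$. *)

theory Defs
  imports Complex_Main
begin

datatype colour = Red | Blue

definition complete_edges :: "'a set \<Rightarrow> 'a set set" where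
  "complete_edges V = {e. e \<subseteq> V \<and> card e = 2}"

(* A red-blue complete graph on V is a map c :: 'a set => colour, of which only the
   values on complete_edges V are ever used.  The walk (v_0, ..., v_t) is the list of
   its t + 1 vertices. *)

definition walks :: "'a set \<Rightarrow> nat \<Rightarrow> 'a list set" where
  "walks V t = {w. length w = t + 1 \<and> set w \<subseteq> V \<and>
                   (\<forall>i\<in>{1..t}. {w ! (i - 1), w ! i} \<in> complete_edges V)}"

definition alternating_walks :: "'a set \<Rightarrow> ('a set \<Rightarrow> colour) \<Rightarrow> nat \<Rightarrow> 'a list set" where
  "alternating_walks V c t = {w \<in> walks V t.
     \<forall>i\<in>{1..t - 1}. c {w ! (i - 1), w ! i} \<noteq> c {w ! i, w ! (i + 1)}}"

definition incident_edges :: "'a set \<Rightarrow> ('a set \<Rightarrow> colour) \<Rightarrow> colour \<Rightarrow> 'a \<Rightarrow> 'a set set" where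
  "incident_edges V c k v = {e \<in> complete_edges V. v \<in> e \<and> c e = k}"

end

theory Submission
  imports Defs
begin

text \<open>
  Alternating walks are the walks of a digraph on the pairs of a vertex and a colour: \<open>(v, k)\<close>
  points to \<open>(u, l)\<close> if \<open>vu\<close> has colour \<open>k\<close> and \<open>l \<noteq> k\<close>, so that \<open>k\<close> is the colour of the next
  edge of the walk. In this digraph the in-degree and the out-degree of each vertex add up to
  \<open>n - 1\<close>, hence by AM-GM its adjacency matrix has numerical radius at most \<open>m = (n - 1) / 2\<close>.
  Berger's power inequality for the numerical radius bounds that of the \<open>t\<close>-th power by \<open>m ^ t\<close>,
  and evaluating the quadratic form at the all-ones vector of squared norm \<open>2 n\<close> gives the bound.
\<close>

section \<open>Powers of a matrix and the numerical radius\<close>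

fun matrix_iter :: "'i set \<Rightarrow> ('i \<Rightarrow> 'i \<Rightarrow> real) \<Rightarrow> ('i \<Rightarrow> real) \<Rightarrow> nat \<Rightarrow> 'i \<Rightarrow> real" where
  "matrix_iter I A x 0 p = x p"
| "matrix_iter I A x (Suc t) p = (\<Sum>q\<in>I. A p q * matrix_iter I A x t q)"

text \<open>The sum is geometric with ratio \<open>z\<close>, a \<open>t\<close>-th root of unity
  different from 1 because \<open>0 < i < t\<close>. Hence averaging over all \<open>t\<close>-th
  roots of unity keeps only the term \<open>i = 0\<close> of a polynomial of degree below
  \<open>t\<close>.\<close>

lemma sum_powers_root_of_unity:
  assumes "0 < i" "i < t"
  shows "(\<Sum>j<t. cis (2 * pi * real j / real t) ^ i) = 0"
proof -
  define z where "z = cis (2 * pi * real i / real t)"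
  have inj: "inj_on (\<lambda>k. cis (2 * pi * real k / real t)) {..<t}"
    using bij_betw_roots_unity[of t] assms by (auto simp: bij_betw_def)
  have "z \<noteq> 1"
    using inj_onD[OF inj, of i 0] assms by (auto simp: z_def)
  moreover have "z ^ t = 1"
    using assms by (simp add: z_def DeMoivre)
  moreover have "cis (2 * pi * real j / real t) ^ i = z ^ j" for j
    by (simp add: z_def DeMoivre mult_ac)
  ultimately show ?thesis
    by (simp add: geometric_sum)
qed

text \<open>
  This is Berger's power inequality in Pearcy's proof: for \<open>\<omega> ^ t = 1\<close> the vector
  \<open>y = (\<Sum>i<t. m ^ (t - 1 - i) * \<omega> ^ i * A ^ i x)\<close> satisfies \<open>(m - \<omega> A) y = m ^ t x - A ^ t x\<close>,
  and the vectors \<open>y\<close> for all \<open>\<omega>\<close> add up to \<open>t * m ^ (t - 1) * x\<close>.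
\<close>

lemma numerical_radius_power:
  fixes A :: "'i \<Rightarrow> 'i \<Rightarrow> real" and x :: "'i \<Rightarrow> real"
  assumes "m > 0"
    and radius: "\<And>f :: 'i \<Rightarrow> complex.
      norm (\<Sum>p\<in>I. (\<Sum>q\<in>I. of_real (A p q) * f q) * cnj (f p)) \<le> m * (\<Sum>p\<in>I. (norm (f p))\<^sup>2)"
  shows "(\<Sum>p\<in>I. matrix_iter I A x t p * x p) \<le> m ^ t * (\<Sum>p\<in>I. (x p)\<^sup>2)"
proof (cases "t = 0")
  case True
  then show ?thesis by (simp add: power2_eq_square)
next
  case False
  define a where "a = matrix_iter I A x"
  define w where "w j = cis (2 * pi * real j / real t)" for j
  define y where "y j p = (\<Sum>i<t. of_real (m ^ (t - 1 - i)) * w j ^ i * of_real (a i p))" for j p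
  have w_pow: "w j ^ t = 1" for j
    using False by (simp add: w_def DeMoivre)
  have resolvent: "of_real m * y j p - w j * (\<Sum>q\<in>I. of_real (A p q) * y j q)
      = of_real (m ^ t * x p - a t p)" for j p
  proof -
    \<comment> \<open>The summands telescope: multiplying by \<open>m\<close> raises the exponent to
      \<open>t - i\<close>, and the factor \<open>w j\<close> together with \<open>A\<close> moves
      on to index \<open>i + 1\<close>. Only \<open>g 0 = m ^ t * x p\<close> and
      \<open>g t = a t p\<close> remain, the latter because \<open>w j ^ t = 1\<close>.\<close>
    define g where "g i = of_real (m ^ (t - i)) * w j ^ i * of_real (a i p)" for i
    have "(\<Sum>q\<in>I. of_real (A p q) * y j q)
        = (\<Sum>i<t. of_real (m ^ (t - 1 - i)) * w j ^ i * of_real (a (Suc i) p))"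
      unfolding y_def a_def sum_distrib_left
      by (subst sum.swap) (simp add: sum_distrib_left mult_ac)
    then have "of_real m * y j p - w j * (\<Sum>q\<in>I. of_real (A p q) * y j q)
        = (\<Sum>i<t. of_real m * (of_real (m ^ (t - 1 - i)) * w j ^ i * of_real (a i p))
            - w j * (of_real (m ^ (t - 1 - i)) * w j ^ i * of_real (a (Suc i) p)))"
      by (simp add: y_def sum_distrib_left sum_subtractf)
    also have "\<dots> = (\<Sum>i<t. g i - g (Suc i))"
    proof (rule sum.cong[OF refl])
      fix i assume "i \<in> {..<t}"
      then have "m ^ (t - i) = m * m ^ (t - 1 - i)"
        by (simp flip: power_Suc add: Suc_diff_Suc)
      then show "of_real m * (of_real (m ^ (t - 1 - i)) * w j ^ i * of_real (a i p))
            - w j * (of_real (m ^ (t - 1 - i)) * w j ^ i * of_real (a (Suc i) p))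
          = g i - g (Suc i)"
        by (simp add: g_def)
    qed
    also have "\<dots> = g 0 - g t"
      by (rule sum_lessThan_telescope')
    also have "\<dots> = of_real (m ^ t * x p - a t p)"
      by (simp add: g_def w_pow a_def)
    finally show ?thesis .
  qed
  have average: "(\<Sum>j<t. y j p) = of_real (real t * m ^ (t - 1) * x p)" for p
  proof -
    have "(\<Sum>j<t. y j p)
        = (\<Sum>i<t. of_real (m ^ (t - 1 - i)) * of_real (a i p) * (\<Sum>j<t. w j ^ i))"
      unfolding y_def sum_distrib_left by (subst sum.swap) (simp add: mult_ac)
    also have "\<dots> = (\<Sum>i<t. if i = 0 then of_real (m ^ (t - 1) * a 0 p * real t) else 0)"
      using sum_powers_root_of_unity[of _ t] by (intro sum.cong) (auto simp: w_def)
    also have "\<dots> = of_real (real t * m ^ (t - 1) * x p)"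
      using False by (simp add: a_def mult_ac)
    finally show ?thesis .
  qed
  define b where "b p = m ^ t * x p - a t p" for p
  define F where "F j = (\<Sum>p\<in>I. (\<Sum>q\<in>I. of_real (A p q) * y j q) * cnj (y j p))" for j
  define G where "G j = (\<Sum>p\<in>I. (norm (y j p))\<^sup>2)" for j
  \<comment> \<open>By \<open>average\<close>, pairing \<open>b\<close> with \<open>x\<close>
    amounts to summing its pairings with all \<open>y j\<close>. By \<open>resolvent\<close>, each
    of these is \<open>m\<close> times the squared norm of \<open>y j\<close> minus
    \<open>w j\<close> times the quadratic form of \<open>A\<close> at \<open>y j\<close>. Since
    \<open>w j\<close> has modulus 1, \<open>radius\<close> makes its real part nonnegative.\<close>
  have "of_real (real t * m ^ (t - 1) * (\<Sum>p\<in>I. b p * x p))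
      = (\<Sum>p\<in>I. of_real (b p) * cnj (\<Sum>j<t. y j p))"
    unfolding average by (simp add: sum_distrib_left mult_ac)
  also have "\<dots> = (\<Sum>j<t. \<Sum>p\<in>I. of_real (b p) * cnj (y j p))"
    unfolding cnj_sum sum_distrib_left by (rule sum.swap)
  also have "\<dots> = (\<Sum>j<t. of_real (m * G j) - w j * F j)"
  proof (rule sum.cong[OF refl])
    fix j
    show "(\<Sum>p\<in>I. of_real (b p) * cnj (y j p)) = of_real (m * G j) - w j * F j"
      unfolding b_def resolvent[symmetric, of _ j] F_def G_def
      by (simp add: algebra_simps sum_subtractf sum_distrib_left complex_norm_square
          del: of_real_power)
  qed
  finally have "real t * m ^ (t - 1) * (\<Sum>p\<in>I. b p * x p)
      = (\<Sum>j<t. m * G j - Re (w j * F j))"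
    by (auto dest: arg_cong[of _ _ Re] simp del: of_real_mult of_real_power of_real_sum times_complex.sel)
  moreover have "Re (w j * F j) \<le> m * G j" for j
    using complex_Re_le_cmod[of "w j * F j"] radius[of "y j"]
    by (simp add: norm_mult w_def F_def G_def)
  ultimately have "0 \<le> real t * m ^ (t - 1) * (\<Sum>p\<in>I. b p * x p)"
    by (simp add: sum_nonneg)
  then have "0 \<le> (\<Sum>p\<in>I. b p * x p)"
    using False \<open>m > 0\<close> by (meson mult_pos_neg not_le of_nat_0_less_iff mult_pos_pos neq0_conv zero_less_power)
  then show ?thesis
    by (simp add: b_def a_def algebra_simps sum_subtractf sum_distrib_left power2_eq_square)
qed

text \<open>After the triangle inequality, AM-GM replaces \<open>norm (f q) * norm (f p)\<close> by
  the mean of the squares. Swapping the indices in one half collects, at each \<open>p\<close>, half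
  the row sum plus half the column sum as the weight of \<open>(norm (f p))\<^sup>2\<close>.\<close>

lemma numerical_radius_le_half_row_plus_column:
  fixes A :: "'i \<Rightarrow> 'i \<Rightarrow> real" and f :: "'i \<Rightarrow> complex"
  assumes nonneg: "\<And>p q. A p q \<ge> 0"
    and deg: "\<And>p. p \<in> I \<Longrightarrow> (\<Sum>q\<in>I. A p q) + (\<Sum>q\<in>I. A q p) \<le> 2 * m"
  shows "norm (\<Sum>p\<in>I. (\<Sum>q\<in>I. of_real (A p q) * f q) * cnj (f p)) \<le> m * (\<Sum>p\<in>I. (norm (f p))\<^sup>2)"
proof -
  have "norm (\<Sum>p\<in>I. (\<Sum>q\<in>I. of_real (A p q) * f q) * cnj (f p))
      \<le> (\<Sum>p\<in>I. \<Sum>q\<in>I. norm (of_real (A p q) * f q * cnj (f p)))"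
    unfolding sum_distrib_right
    by (intro order_trans[OF norm_sum] sum_mono order_trans[OF norm_sum] order_refl)
  also have "\<dots> \<le> (\<Sum>p\<in>I. \<Sum>q\<in>I. A p q * (((norm (f p))\<^sup>2 + (norm (f q))\<^sup>2) / 2))"
  proof (intro sum_mono)
    fix p q
    have "norm (f q) * norm (f p) \<le> ((norm (f p))\<^sup>2 + (norm (f q))\<^sup>2) / 2"
      using sum_squares_bound[of "norm (f p)" "norm (f q)"] by (simp add: mult_ac)
    then show "norm (of_real (A p q) * f q * cnj (f p))
        \<le> A p q * (((norm (f p))\<^sup>2 + (norm (f q))\<^sup>2) / 2)"
      using nonneg[of p q] by (simp add: norm_mult mult.assoc mult_left_mono)
  qed
  also have "\<dots> = (\<Sum>p\<in>I. \<Sum>q\<in>I. A p q * (norm (f p))\<^sup>2 / 2)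
      + (\<Sum>p\<in>I. \<Sum>q\<in>I. A p q * (norm (f q))\<^sup>2 / 2)"
    by (simp add: sum.distrib[symmetric] field_simps)
  also have "(\<Sum>p\<in>I. \<Sum>q\<in>I. A p q * (norm (f q))\<^sup>2 / 2)
      = (\<Sum>p\<in>I. \<Sum>q\<in>I. A q p * (norm (f p))\<^sup>2 / 2)"
    by (rule sum.swap)
  also have "(\<Sum>p\<in>I. \<Sum>q\<in>I. A p q * (norm (f p))\<^sup>2 / 2)
      + (\<Sum>p\<in>I. \<Sum>q\<in>I. A q p * (norm (f p))\<^sup>2 / 2)
      = (\<Sum>p\<in>I. ((\<Sum>q\<in>I. A p q) + (\<Sum>q\<in>I. A q p)) / 2 * (norm (f p))\<^sup>2)"
    by (simp add: sum.distrib sum_distrib_right sum_divide_distrib add_divide_distrib distrib_right)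
  also have "\<dots> \<le> (\<Sum>p\<in>I. m * (norm (f p))\<^sup>2)"
    using deg by (intro sum_mono mult_right_mono) (auto simp: field_simps)
  finally show ?thesis
    by (simp add: sum_distrib_left)
qed

section \<open>Prepending a vertex to a walk\<close>

lemma complete_edges_insert_iff: "{u, v} \<in> complete_edges V \<longleftrightarrow> u \<in> V \<and> v \<in> V \<and> u \<noteq> v"
  by (auto simp: complete_edges_def card_2_iff doubleton_eq_iff)

lemma ball_1_Suc_iff: "(\<forall>i\<in>{1..Suc t}. P i) \<longleftrightarrow> P 1 \<and> (\<forall>i\<in>{1..t}. P (Suc i))"
proof -
  have "{1..Suc t} = insert 1 (Suc ` {1..t})"
    by auto
  then show ?thesis by (simp only: ball_simps)
qed

lemma walks_Suc_iff:
  "v # u # w \<in> walks V (Suc t) \<longleftrightarrow> v \<in> V \<and> v \<noteq> u \<and> u # w \<in> walks V t"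
proof -
  have "(\<forall>i\<in>{1..Suc t}. {(v # u # w) ! (i - 1), (v # u # w) ! i} \<in> complete_edges V) \<longleftrightarrow>
      {v, u} \<in> complete_edges V \<and>
      (\<forall>i\<in>{1..t}. {(u # w) ! (i - 1), (u # w) ! i} \<in> complete_edges V)"
    (is "(\<forall>i\<in>{1..Suc t}. ?P i) \<longleftrightarrow> ?E \<and> (\<forall>i\<in>{1..t}. ?Q i)")
  proof -
    have "?P (Suc i) = ?Q i" if "i \<in> {1..t}" for i
      using that by (cases i) auto
    then show ?thesis by (subst ball_1_Suc_iff) simp
  qed
  then show ?thesis
    by (auto simp: walks_def complete_edges_insert_iff)
qed

text \<open>Prepending \<open>v\<close> adds one colour condition, at the junction \<open>u\<close>.
  The guard \<open>t > 0\<close> is there because for \<open>t = 0\<close> the new walk has a single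
  edge and \<open>w ! 0\<close> does not exist.\<close>

lemma alternating_walks_Suc_iff:
  "v # u # w \<in> alternating_walks V c (Suc t) \<longleftrightarrow>
     v \<in> V \<and> v \<noteq> u \<and> u # w \<in> alternating_walks V c t \<and>
     (t > 0 \<longrightarrow> c {v, u} \<noteq> c {u, w ! 0})"
proof -
  have "(\<forall>i\<in>{1..t}. c {(v # u # w) ! (i - 1), (v # u # w) ! i}
                    \<noteq> c {(v # u # w) ! i, (v # u # w) ! (i + 1)}) \<longleftrightarrow>
      (t > 0 \<longrightarrow> c {v, u} \<noteq> c {u, w ! 0}) \<and>
      (\<forall>i\<in>{1..t - 1}. c {(u # w) ! (i - 1), (u # w) ! i} \<noteq> c {(u # w) ! i, (u # w) ! (i + 1)})"
    (is "(\<forall>i\<in>{1..t}. ?P i) \<longleftrightarrow> (_ \<longrightarrow> ?E) \<and> (\<forall>i\<in>{1..t - 1}. ?Q i)")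
  proof (cases t)
    case (Suc s)
    have "?P (Suc i) = ?Q i" if "i \<in> {1..s}" for i
      using that by (cases i) auto
    then show ?thesis
      unfolding Suc by (subst ball_1_Suc_iff) simp
  qed simp
  then show ?thesis
    by (auto simp: alternating_walks_def walks_Suc_iff)
qed

section \<open>Counting alternating walks by matrix iteration\<close>

lemma finite_alternating_walks:
  assumes "finite V"
  shows "finite (alternating_walks V c t)"
proof (rule finite_subset)
  show "alternating_walks V c t \<subseteq> {w. set w \<subseteq> V \<and> length w = t + 1}"
    by (auto simp: alternating_walks_def walks_def)
qed (use assms finite_lists_length_eq in blast)

text \<open>The colour \<open>snd p\<close> is that of the first edge; for \<open>t = 0\<close> there is none, and the trivial walk is
  counted once for each colour.\<close>

definition alternating_walks_from ::
    "'a set \<Rightarrow> ('a set \<Rightarrow> colour) \<Rightarrow> nat \<Rightarrow> 'a \<times> colour \<Rightarrow> 'a list set" where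
  "alternating_walks_from V c t p =
     {w \<in> alternating_walks V c t. w ! 0 = fst p \<and> (t > 0 \<longrightarrow> c {w ! 0, w ! 1} = snd p)}"

definition alternation_matrix :: "('a set \<Rightarrow> colour) \<Rightarrow> 'a \<times> colour \<Rightarrow> 'a \<times> colour \<Rightarrow> real" where
  "alternation_matrix c p q =
     (if fst p \<noteq> fst q \<and> c {fst p, fst q} = snd p \<and> snd q \<noteq> snd p then 1 else 0)"

lemma UNIV_colour: "(UNIV :: colour set) = {Red, Blue}"
  using colour.exhaust by auto

text \<open>Deleting the first vertex leaves a walk from a neighbour of \<open>v\<close> along
  colour \<open>k\<close> that continues in the other colour. Each such neighbour occurs in exactly
  one pair \<open>q\<close>, so even for \<open>t = 0\<close> its trivial walk is taken
  once.\<close>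

lemma alternating_walks_from_Suc:
  assumes "v \<in> V"
  shows "alternating_walks_from V c (Suc t) (v, k) =
    (#) v ` (\<Union>q\<in>{q \<in> V \<times> UNIV. v \<noteq> fst q \<and> c {v, fst q} = k \<and> snd q \<noteq> k}.
               alternating_walks_from V c t q)" (is "?L = ?R")
proof
  show "?L \<subseteq> ?R"
  proof
    fix x assume x: "x \<in> ?L"
    then have "length x = Suc (Suc t)"
      by (auto simp: alternating_walks_from_def alternating_walks_def walks_def)
    with x obtain u w where w: "x = v # u # w"
      by (auto simp: alternating_walks_from_def length_Suc_conv)
    with x have uw: "u # w \<in> alternating_walks V c t" "v \<noteq> u" "c {v, u} = k"
        "t > 0 \<longrightarrow> k \<noteq> c {u, w ! 0}"
      by (auto simp: alternating_walks_from_def alternating_walks_Suc_iff)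
    \<comment> \<open>The colour other than \<open>k\<close>. If \<open>t > 0\<close>, it is forced
      to be the colour of the next edge; if \<open>t = 0\<close>, it is merely the label of the
      trivial walk.\<close>
    define l where "l = (if k = Red then Blue else Red)"
    have "l \<noteq> k" and l: "\<And>j. j \<noteq> k \<Longrightarrow> j = l"
      using colour.exhaust by (auto simp: l_def)
    have "u \<in> V"
      using uw(1) by (auto simp: alternating_walks_def walks_def)
    moreover have "u # w \<in> alternating_walks_from V c t (u, l)"
      using uw l[of "c {u, w ! 0}"] by (auto simp: alternating_walks_from_def)
    ultimately show "x \<in> ?R"
      using uw \<open>l \<noteq> k\<close> unfolding w by (intro imageI UN_I[of "(u, l)"]) auto
  qed
  show "?R \<subseteq> ?L"
  proof
    fix x assume "x \<in> ?R"
    then obtain u l w where q: "u \<in> V" "v \<noteq> u" "c {v, u} = k" "l \<noteq> k"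
      and x: "x = v # w" and w: "w \<in> alternating_walks_from V c t (u, l)"
      by auto
    then obtain w' where "w = u # w'"
      by (cases w) (auto simp: alternating_walks_from_def alternating_walks_def walks_def)
    with q w assms show "x \<in> ?L"
      by (auto simp: x alternating_walks_from_def alternating_walks_Suc_iff)
  qed
qed

lemma card_alternating_walks_from:
  assumes "finite V" and "p \<in> V \<times> UNIV"
  shows "real (card (alternating_walks_from V c t p))
    = matrix_iter (V \<times> UNIV) (alternation_matrix c) (\<lambda>_. 1) t p"
  using assms(2)
proof (induction t arbitrary: p)
  case 0
  then have "alternating_walks_from V c 0 p = {[fst p]}"
    by (auto simp: alternating_walks_from_def alternating_walks_def walks_def length_Suc_conv)
  then show ?case by simp
next
  case (Suc t)
  obtain v k where p: "p = (v, k)" "v \<in> V"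
    using Suc.prems by auto
  define Q where "Q = {q \<in> V \<times> UNIV. v \<noteq> fst q \<and> c {v, fst q} = k \<and> snd q \<noteq> k}"
  have fin: "finite (V \<times> (UNIV :: colour set))"
    using assms(1) by (simp add: UNIV_colour)
  then have "finite Q"
    by (simp add: Q_def)
  have "card (alternating_walks_from V c (Suc t) p)
      = card (\<Union>q\<in>Q. alternating_walks_from V c t q)"
    unfolding p(1) alternating_walks_from_Suc[OF p(2)] Q_def by (rule card_image) simp
  also have "\<dots> = (\<Sum>q\<in>Q. card (alternating_walks_from V c t q))"
  proof (rule card_UN_disjoint[OF \<open>finite Q\<close>])
    show "\<forall>q\<in>Q. finite (alternating_walks_from V c t q)"
      using finite_alternating_walks[OF assms(1), of c t] by (simp add: alternating_walks_from_def)
    \<comment> \<open>With two colours, all of \<open>Q\<close> carries the colour other than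
      \<open>k\<close>. This gives disjointness also for \<open>t = 0\<close>, where a walk
      determines its start but not the colour of its pair.\<close>
    have same_colour: "snd q = snd q'" if "q \<in> Q" "q' \<in> Q" for q q'
      using that by (cases "snd q"; cases "snd q'"; cases k) (auto simp: Q_def)
    have "q = q'" if "q \<in> Q" "q' \<in> Q" "w \<in> alternating_walks_from V c t q"
      "w \<in> alternating_walks_from V c t q'" for q q' w
      using same_colour[of q q'] that by (auto simp: alternating_walks_from_def prod_eq_iff)
    then show "\<forall>q\<in>Q. \<forall>q'\<in>Q. q \<noteq> q' \<longrightarrow>
        alternating_walks_from V c t q \<inter> alternating_walks_from V c t q' = {}"
      by blast
  qed
  also have "real \<dots> = (\<Sum>q\<in>Q. matrix_iter (V \<times> UNIV) (alternation_matrix c) (\<lambda>_. 1) t q)"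
    using Suc.IH by (simp add: Q_def)
  also have "\<dots> = matrix_iter (V \<times> UNIV) (alternation_matrix c) (\<lambda>_. 1) (Suc t) p"
    unfolding Q_def sum.inter_filter[OF fin]
    by (auto simp: p alternation_matrix_def intro!: sum.cong)
  finally show ?case .
qed

text \<open>As \<open>t \<ge> 1\<close>, a walk has a first edge, whose colour selects a unique
  starting pair; for \<open>t = 0\<close> every walk would be counted twice.\<close>

lemma card_alternating_walks:
  assumes "finite V" and "t \<ge> 1"
  shows "real (card (alternating_walks V c t))
    = (\<Sum>p\<in>V \<times> UNIV. matrix_iter (V \<times> UNIV) (alternation_matrix c) (\<lambda>_. 1) t p)"
proof -
  have "alternating_walks V c t = (\<Union>p\<in>V \<times> UNIV. alternating_walks_from V c t p)"
  proof -
    have "w ! 0 \<in> V" if "w \<in> alternating_walks V c t" for w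
      using that by (auto simp: alternating_walks_def walks_def)
    then show ?thesis
      by (auto simp: alternating_walks_from_def)
  qed
  moreover have "card (\<Union>p\<in>V \<times> UNIV. alternating_walks_from V c t p)
      = (\<Sum>p\<in>V \<times> UNIV. card (alternating_walks_from V c t p))"
    using assms finite_alternating_walks[OF assms(1), of c t]
    by (intro card_UN_disjoint) (auto simp: alternating_walks_from_def UNIV_colour)
  ultimately show ?thesis
    using card_alternating_walks_from[OF assms(1)] by simp
qed

section \<open>Colour degrees as row and column sums\<close>

definition colour_degree :: "'a set \<Rightarrow> ('a set \<Rightarrow> colour) \<Rightarrow> colour \<Rightarrow> 'a \<Rightarrow> nat" where
  "colour_degree V c k v = card {u \<in> V. u \<noteq> v \<and> c {v, u} = k}"

lemma card_incident_edges:
  assumes "v \<in> V"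
  shows "card (incident_edges V c k v) = colour_degree V c k v"
proof -
  have "incident_edges V c k v = (\<lambda>u. {v, u}) ` {u \<in> V. u \<noteq> v \<and> c {v, u} = k}"
    using assms
    by (auto simp: incident_edges_def complete_edges_def card_2_iff doubleton_eq_iff insert_commute)
  moreover have "inj_on (\<lambda>u. {v, u}) {u \<in> V. u \<noteq> v \<and> c {v, u} = k}"
    by (auto simp: inj_on_def doubleton_eq_iff)
  ultimately show ?thesis
    by (simp add: colour_degree_def card_image)
qed

lemma colour_degree_add:
  assumes "finite V" "v \<in> V" "k \<noteq> l"
  shows "colour_degree V c k v + colour_degree V c l v = card V - 1"
proof -
  have "{u \<in> V. u \<noteq> v \<and> c {v, u} = k} \<union> {u \<in> V. u \<noteq> v \<and> c {v, u} = l} = V - {v}"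
    using assms(3) colour.exhaust by (cases k; cases l) auto
  moreover have "{u \<in> V. u \<noteq> v \<and> c {v, u} = k} \<inter> {u \<in> V. u \<noteq> v \<and> c {v, u} = l} = {}"
    using assms(3) by auto
  ultimately show ?thesis
    using assms by (simp add: colour_degree_def flip: card_Un_disjoint)
qed

text \<open>Each neighbour of \<open>v\<close> along colour \<open>k\<close> gives one successor,
  labelled with the other colour.\<close>

lemma alternation_matrix_row_sum:
  assumes "finite V"
  shows "(\<Sum>q\<in>V \<times> UNIV. alternation_matrix c (v, k) q) = real (colour_degree V c k v)"
proof -
  have "(\<Sum>q\<in>V \<times> UNIV. alternation_matrix c (v, k) q)
      = (\<Sum>u\<in>V. if u \<noteq> v \<and> c {v, u} = k then 1 else 0)"
    unfolding sum.cartesian_product' UNIV_colour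
    by (cases k) (auto simp: alternation_matrix_def intro!: sum.cong)
  then show ?thesis
    using assms by (simp add: colour_degree_def sum.inter_filter[symmetric])
qed

text \<open>A predecessor of \<open>(v, k)\<close> must be labelled \<open>l\<close> and joined to
  \<open>v\<close> by an edge of colour \<open>l\<close>. Thus the row and column sums at
  \<open>(v, k)\<close> are the two colour degrees of \<open>v\<close>.\<close>

lemma alternation_matrix_column_sum:
  assumes "finite V" "k \<noteq> l"
  shows "(\<Sum>p\<in>V \<times> UNIV. alternation_matrix c p (v, k)) = real (colour_degree V c l v)"
proof -
  have "(\<Sum>p\<in>V \<times> UNIV. alternation_matrix c p (v, k))
      = (\<Sum>u\<in>V. if u \<noteq> v \<and> c {v, u} = l then 1 else 0)"
    unfolding sum.cartesian_product' UNIV_colour using assms(2)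
    by (cases k; cases l) (auto simp: alternation_matrix_def insert_commute intro!: sum.cong)
  then show ?thesis
    using assms by (simp add: colour_degree_def sum.inter_filter[symmetric])
qed

section \<open>The equality case and the bound\<close>

lemma matrix_iter_const_row_sum:
  assumes "\<And>p. p \<in> I \<Longrightarrow> (\<Sum>q\<in>I. A p q) = m" and "p \<in> I"
  shows "matrix_iter I A (\<lambda>_. 1) t p = m ^ t"
  using assms(2)
proof (induction t arbitrary: p)
  case (Suc t)
  then have "matrix_iter I A (\<lambda>_. 1) (Suc t) p = (\<Sum>q\<in>I. A p q) * m ^ t"
    by (simp add: sum_distrib_right)
  with Suc.prems show ?case by (simp add: assms(1))
qed simp

theorem theorem1p3:
  fixes V :: "'a set" and c :: "'a set \<Rightarrow> colour" and n t :: nat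
  assumes "finite V" and "card V = n" and "n \<ge> 1" and "t \<ge> 1"
  shows "real (card (alternating_walks V c t)) \<le> 2 * real n * ((real n - 1) / 2) ^ t
    \<and> ((\<forall>v\<in>V. real (card (incident_edges V c Red v)) = (real n - 1) / 2
             \<and> real (card (incident_edges V c Blue v)) = (real n - 1) / 2)
       \<longrightarrow> real (card (alternating_walks V c t)) = 2 * real n * ((real n - 1) / 2) ^ t)"
proof -
  define m where "m = (real n - 1) / 2"
  define I where "I = V \<times> (UNIV :: colour set)"
  define A where "A = alternation_matrix c"
  have card_I: "real (card I) = 2 * real n"
    using assms by (simp add: I_def UNIV_colour card_cartesian_product)
  have count: "real (card (alternating_walks V c t)) = (\<Sum>p\<in>I. matrix_iter I A (\<lambda>_. 1) t p)"
    unfolding I_def A_def by (rule card_alternating_walks) (use assms in auto)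
  have equality: "real (card (alternating_walks V c t)) = 2 * real n * m ^ t"
    if "\<And>v k. v \<in> V \<Longrightarrow> real (colour_degree V c k v) = m"
  proof -
    have "(\<Sum>q\<in>I. A p q) = m" if "p \<in> I" for p
      using that \<open>\<And>v k. v \<in> V \<Longrightarrow> real (colour_degree V c k v) = m\<close>
        alternation_matrix_row_sum[OF assms(1), of c "fst p" "snd p"]
      by (auto simp: I_def A_def)
    then show ?thesis
      using card_I by (simp add: count matrix_iter_const_row_sum)
  qed
  have deg: "real (colour_degree V c k v) + real (colour_degree V c l v) = 2 * m"
    if "v \<in> V" "k \<noteq> l" for v k l
    using colour_degree_add[OF assms(1) that, of c] assms by (simp add: m_def)
  have bound: "real (card (alternating_walks V c t)) \<le> 2 * real n * m ^ t"
  \<comment> \<open>The power inequality is available only for \<open>m > 0\<close>. If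
    \<open>m = 0\<close>, that is \<open>n = 1\<close>, all colour degrees vanish and so equal
    \<open>m\<close>, and the equality case applies.\<close>
  proof (cases "m = 0")
    case True
    have "colour_degree V c k v = 0" if "v \<in> V" for v k
      using deg[OF that, of Red Blue] True by (cases k) auto
    then show ?thesis
      using equality True by simp
  next
    case False
    then have "m > 0"
      using assms by (simp add: m_def)
    have "(\<Sum>q\<in>I. A p q) + (\<Sum>q\<in>I. A q p) \<le> 2 * m" if p_in: "p \<in> I" for p
    proof -
      obtain v k where p: "p = (v, k)" "v \<in> V"
        using p_in by (auto simp: I_def)
      obtain l where "k \<noteq> l"
        by (metis colour.distinct(1))
      then show ?thesis
        using deg[OF p(2) \<open>k \<noteq> l\<close>] alternation_matrix_row_sum[OF assms(1)]
          alternation_matrix_column_sum[OF assms(1) \<open>k \<noteq> l\<close>]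
        by (simp add: p(1) I_def A_def)
    qed
    then have "(\<Sum>p\<in>I. matrix_iter I A (\<lambda>_. 1) t p * 1) \<le> m ^ t * (\<Sum>p\<in>I. 1\<^sup>2)"
      by (intro numerical_radius_power[OF \<open>m > 0\<close>] numerical_radius_le_half_row_plus_column)
        (auto simp: A_def alternation_matrix_def)
    then show ?thesis
      using card_I by (simp add: count mult_ac)
  qed
  have "real (card (alternating_walks V c t)) = 2 * real n * m ^ t"
    if "\<forall>v\<in>V. real (card (incident_edges V c Red v)) = m
            \<and> real (card (incident_edges V c Blue v)) = m"
  proof (rule equality)
    fix v k assume "v \<in> V"
    with that show "real (colour_degree V c k v) = m"
      by (cases k) (auto simp: card_incident_edges)
  qed
  with bound show ?thesis
    unfolding m_def by blast
qed

end
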